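(* For $0\le\theta<\infty$, $a>0$ and $0\le\alpha<1$, $$\mathrm{Ci}(a,a\theta)=\frac{(a\theta)^{a}\exp\{\mathcal{E}_{R}(a,\theta)\}}{a\sqrt{\theta^{2}+1}}\cos\left(a\theta-\arctan(\theta)+\mathcal{E}_{I}(a,\theta)\right),$$ $$\mathrm{Si}(a,a\theta)=\frac{(a\theta)^{a}\exp\{\mathcal{E}_{R}(a,\theta)\}}{a\sqrt{\theta^{2}+1}}\sin\left(a\theta-\arctan(\theta)+\mathcal{E}_{I}(a,\theta)\right),$$ $$\mathrm{Ti}(a,a\theta,\alpha)=\frac{(a\theta)^{a}\exp\{\mathcal{E}_{R}(a,\theta)\}}{a\sqrt{\theta^{2}+1}}\cos\left(a\theta-\arctan(\theta)-\alpha\pi+\mathcal{E}_{I}(a,\theta)\right),$$ where, as $a\to\infty$, uniformly for $0\le\theta<\infty$, $$\mathcal{E}_{R}(a,\theta)\sim\sum_{s=1}^{\infty}(-1)^{s}\frac{\Re\{E^{-}_{s}(-i\theta)\}}{a^{s}},\qquad \mathcal{E}_{I}(a,\theta)\sim\sum_{s=1}^{\infty}(-1)^{s}\frac{\Im\{E^{-}_{s}(-i\theta)\}}{a^{s}}.$$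
   Context: Generalised trigonometric integrals, for $a>0$: $\mathrm{Ci}(a,z)=\int_0^z t^{a-1}\cos t\,dt$, $\mathrm{Si}(a,z)=\int_0^z t^{a-1}\sin t\,dt$, and $\mathrm{Ti}(a,z,\alpha)=\mathrm{Ci}(a,z)\cos(\pi\alpha)+\mathrm{Si}(a,z)\sin(\pi\alpha)$. The functions $\mathcal{E}_R,\mathcal{E}_I$ are real-valued and the same in all three formulas. Coefficients: $F^{-}_{0}(z)=-\dfrac{z}{(z-1)^{2}}$, $F^{-}_{1}(z)=-\dfrac{2z(z+1)}{(z-1)^{4}}$, and for $s=1,2,3,\ldots$ $$F^{-}_{s+1}(z)=\frac{z}{1-z}\frac{dF^{-}_{s}(z)}{dz}-\frac12\sum_{j=0}^{s}F^{-}_{j}(z)F^{-}_{s-j}(z).$$ For $s\ge1$, $E^{-}_{s}(z)=\int_{0}^{z}\frac{(t-1)F^{-}_{s}(t)}{2t}\,dt$, which is a rational function with $E^{-}_{s}(0)=0$. For example $E^{-}_{1}(z)=\frac{z}{(z-1)^{2}}$, $E^{-}_{2}(z)=\frac{z(3z+2)}{2(z-1)^{4}}$, $E^{-}_{3}(z)=\frac{z(13z^{2}+21z+3)}{3(z-1)^{6}}$.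
   Formalization: The points a=1, θ=2πk (k=1,2,…) are excluded from the three formulas: there Ci(1,2πk)=Si(1,2πk)=0, while the prefactor is positive and cos and sin have no common zero, so no real E_R, E_I can satisfy the formulas. *)

theory Defs
  imports "HOL-Complex_Analysis.Complex_Analysis"
begin

(* The generalised trigonometric integrals, for a > 0 and real z \<ge> 0.
   The value of the integrand at t = 0 (where 0 powr _ = 0) does not affect the integral.
   For z > 0, gen_Ci a z and gen_Si a z vanish simultaneously exactly when a = 1 and
   z = 2 * pi * k with k = 1, 2, ...; only there no modulus-phase form with a positive modulus exists. *)

definition gen_Ci :: "real \<Rightarrow> real \<Rightarrow> real" where
  "gen_Ci a z = integral {0..z} (\<lambda>t. t powr (a - 1) * cos t)"

definition gen_Si :: "real \<Rightarrow> real \<Rightarrow> real" where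
  "gen_Si a z = integral {0..z} (\<lambda>t. t powr (a - 1) * sin t)"

definition gen_Ti :: "real \<Rightarrow> real \<Rightarrow> real \<Rightarrow> real" where
  "gen_Ti a z \<alpha> = gen_Ci a z * cos (pi * \<alpha>) + gen_Si a z * sin (pi * \<alpha>)"

(* All F_minus s are rational functions whose only possible pole is z = 1. *)

fun F_minus :: "nat \<Rightarrow> complex \<Rightarrow> complex" where
  "F_minus 0 = (\<lambda>z. - (z / (z - 1) ^ 2))"
| "F_minus (Suc 0) = (\<lambda>z. - (2 * z * (z + 1) / (z - 1) ^ 4))"
| "F_minus (Suc (Suc s)) = (\<lambda>z. z / (1 - z) * deriv (F_minus (Suc s)) z
     - 1 / 2 * (\<Sum>j\<in>{0..Suc s}. F_minus j z * F_minus (Suc s - j) z))"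

(* The integral from 0 to z is taken along the straight segment, which avoids the pole t = 1
   unless z is real with z \<ge> 1. The singularity of the integrand at t = 0 is removable. *)

definition E_minus :: "nat \<Rightarrow> complex \<Rightarrow> complex" where
  "E_minus s z = contour_integral (linepath 0 z) (\<lambda>t. (t - 1) * F_minus s t / (2 * t))"

(* f a x ~ (\<Sum>s=1..\<infinity>. c s x / a ^ s) as a \<rightarrow> \<infinity>, uniformly for x \<in> X, in the sense of Poincare:
   each remainder is O(a ^ -(N + 1)) with a constant that does not depend on x. *)

definition uniform_asymp_expansion ::
    "(real \<Rightarrow> 'x \<Rightarrow> real) \<Rightarrow> (nat \<Rightarrow> 'x \<Rightarrow> real) \<Rightarrow> 'x set \<Rightarrow> bool" where
  "uniform_asymp_expansion f c X \<longleftrightarrow>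
     (\<forall>N. \<exists>C. \<forall>\<^sub>F a in at_top. \<forall>x\<in>X.
        \<bar>f a x - (\<Sum>s=1..N. c s x / a ^ s)\<bar> \<le> C / a ^ (N + 1))"

end

theory Submission
  imports Defs
begin

text \<open>
  Put \<open>J(a, x) = \<integral> t\<^sup>a\<^sup>-\<^sup>1 e\<^sup>i\<^sup>t dt\<close> over \<open>[0, x]\<close>, so that \<open>Ci = Re J\<close> and \<open>Si = Im J\<close>, and factor
  \<open>J(a, a\<theta>) = ((a\<theta>)\<^sup>a e\<^sup>i\<^sup>a\<^sup>\<theta> / (a (1 + i\<theta>))) H(a, \<theta>)\<close>.  Since \<open>1 + i\<theta>\<close> has modulus
  \<open>sqrt (1 + \<theta>\<^sup>2)\<close> and argument \<open>arctan \<theta>\<close>, all three formulas hold with \<open>E\<^sub>R + i E\<^sub>I = Ln H\<close> as soon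
  as \<open>H \<noteq> 0\<close>.  The theorem therefore amounts to a statement about the zeros of \<open>J\<close> (\<open>osc_nonzero\<close>) plus a
  uniform expansion of \<open>Ln H\<close> (\<open>log_factor_expansion\<close>).

  Zeros: for \<open>a < 1\<close> the weight \<open>t\<^sup>a\<^sup>-\<^sup>1\<close> decreases and an integration by parts gives \<open>Im J > 0\<close>;
  for \<open>a > 1\<close> it increases and the same computation, run from the other end of the interval,
  gives \<open>Im (e\<^sup>-\<^sup>i\<^sup>x J) < 0\<close>; for \<open>a = 1\<close> the integral is elementary.

  Expansion: with \<open>z = -i\<theta>\<close>, the function \<open>h = H / (1 - z)\<close> solves the inhomogeneous first order equation
  \<open>\<epsilon> z h' + (1 - z) h = 1\<close>, where \<open>\<epsilon> = 1/a\<close>.  Substituting \<open>h = e\<^sup>S / (1 - z)\<close> and taking a logarithmic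
  derivative gives a Riccati equation for \<open>h' / h\<close>; solving it by a power series in \<open>\<epsilon>\<close> is exactly
  the recursion for the \<open>F\<^sub>s\<close>, with \<open>S = \<Sum> (-1)\<^sup>s E\<^sub>s \<epsilon>\<^sup>s\<close>.  In the variable
  \<open>y = 1 / (1 - z)\<close> every \<open>F\<^sub>s\<close>, and every \<open>E\<^sub>s\<close> with \<open>s \<ge> 1\<close>, is a polynomial
  (\<open>F_minus_eq_poly\<close>, \<open>E_minus_eq_poly\<close>), and the half-line \<open>\<theta> \<ge> 0\<close> goes into the closed
  unit disc.  Compactness of the disc is what makes every estimate uniform in \<open>\<theta>\<close>.

  If \<open>S\<close> is the sum truncated after \<open>\<epsilon>\<^sup>N\<close>, then \<open>e\<^sup>S / (1 - z)\<close> satisfies the first order equation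
  with the right-hand side \<open>1\<close> replaced by \<open>1 - \<delta>\<close>.  The \<open>y\<close>-derivative of the defect \<open>\<delta>\<close> is \<open>O(\<epsilon>\<^sup>N\<^sup>+\<^sup>1)\<close>
  by the recursion (\<open>poly_resid_expo_sum\<close>, \<open>exp_resid_bound\<close>) and \<open>\<delta> = 0\<close> at \<open>y = 1\<close>, so \<open>\<delta> = O(\<epsilon>\<^sup>N\<^sup>+\<^sup>1)\<close>.
  An integration by parts (\<open>osc_by_parts\<close>) converts this into
  \<open>H = e\<^sup>S + O(\<epsilon>\<^sup>N\<^sup>+\<^sup>1)\<close>, uniformly in \<open>\<theta>\<close> (\<open>osc_factor_approx\<close>); taking logarithms ends the proof.
\<close>

section \<open>The coefficients as polynomials in \<open>1 / (1 - z)\<close>\<close>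

text \<open>
  If \<open>h = y e\<^sup>S\<close> then \<open>(z / (1 - z)) (d/dz) log h = y\<^sup>2 (y - 1) (1/y + dS/dy) = y (y - 1) + y\<^sup>2 (y - 1) dS/dy\<close>.
  This is the coefficient of \<open>\<epsilon>\<^sup>k\<close> of that logarithmic derivative when \<open>dS/dy\<close> has coefficient
  \<open>p\<close>; the factor \<open>y\<close> of \<open>h\<close> contributes to order \<open>0\<close> only.
\<close>
definition log_deriv_coeff :: "nat \<Rightarrow> complex poly \<Rightarrow> complex poly" where
  "log_deriv_coeff k p = (if k = 0 then [:0, -1, 1:] else 0) + [:0, 0, -1, 1:] * p"

text \<open>
  The coefficient of \<open>\<epsilon>\<^sup>k\<close> in \<open>dS/dy\<close>.  The first order equation for \<open>h\<close> reads
  \<open>e\<^sup>S (1 + \<epsilon> P) = 1\<close>, where \<open>P\<close> is the logarithmic derivative above; differentiating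
  in \<open>y\<close> gives \<open>dS/dy (1 + \<epsilon> P) + \<epsilon> dP/dy = 0\<close>, which is this recursion.
\<close>
fun expo_deriv :: "nat \<Rightarrow> complex poly" where
  "expo_deriv 0 = 0"
| "expo_deriv (Suc m) = - pderiv (log_deriv_coeff m (expo_deriv m)) - (\<Sum>j\<in>{0..m}. expo_deriv j * log_deriv_coeff (m - j) (expo_deriv (m - j)))"

abbreviation log_deriv :: "nat \<Rightarrow> complex poly" where
  "log_deriv k \<equiv> log_deriv_coeff k (expo_deriv k)"

declare expo_deriv.simps [simp del]

lemma poly_log_deriv_0: "poly (log_deriv 0) y = y * (y - 1)"
  by (simp add: log_deriv_coeff_def expo_deriv.simps(1) algebra_simps)

lemma poly_log_deriv_Suc: "poly (log_deriv (Suc k)) y = y\<^sup>2 * (y - 1) * poly (expo_deriv (Suc k)) y"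
  by (simp add: log_deriv_coeff_def algebra_simps power2_eq_square)

text \<open>
  Multiplying the recursion by \<open>y\<^sup>2 (y - 1)\<close> closes it in terms of the logarithmic derivative
  alone.  The last term corrects for the part \<open>y (y - 1)\<close> of order \<open>0\<close>, which does not come from \<open>S\<close>;
  without it the equation would have the shape of the recursion for \<open>F_minus\<close> up to constants.
\<close>
lemma log_deriv_recursion:
  fixes y :: complex
  shows "poly (log_deriv (Suc m)) y = - (y\<^sup>2 * (y - 1) * poly (pderiv (log_deriv m)) y)
     - (\<Sum>j=0..m. poly (log_deriv j) y * poly (log_deriv (m - j)) y) + poly (log_deriv 0) y * poly (log_deriv m) y"
proof -
  let ?c = "y\<^sup>2 * (y - 1)"
  have "?c * poly (expo_deriv (Suc m)) y = - (?c * poly (pderiv (log_deriv m)) y)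
     - (\<Sum>j=0..m. ?c * poly (expo_deriv j) y * poly (log_deriv (m - j)) y)"
    by (simp add: expo_deriv.simps(2) poly_sum sum_distrib_left algebra_simps)
  also have "(\<Sum>j=0..m. ?c * poly (expo_deriv j) y * poly (log_deriv (m - j)) y)
     = (\<Sum>j=0..m. poly (log_deriv j) y * poly (log_deriv (m - j)) y) - poly (log_deriv 0) y * poly (log_deriv m) y"
  proof -
    have c: "?c * poly (expo_deriv j) y = poly (log_deriv j) y - (if j = 0 then poly (log_deriv 0) y else 0)" for j
      by (cases j) (simp_all add: poly_log_deriv_Suc expo_deriv.simps(1))
    have "(\<Sum>j=0..m. ?c * poly (expo_deriv j) y * poly (log_deriv (m - j)) y) =
       (\<Sum>j=0..m. poly (log_deriv j) y * poly (log_deriv (m - j)) y - (if j = 0 then poly (log_deriv 0) y * poly (log_deriv m) y else 0))"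
      unfolding c by (intro sum.cong) (auto simp: left_diff_distrib)
    thus ?thesis by (simp add: sum_subtractf)
  qed
  finally show ?thesis by (simp add: poly_log_deriv_Suc)
qed

text \<open>
  The value at \<open>0\<close> is half of what the general formula would give.  This is how the recursion for
  \<open>F_minus\<close>, with its full convolution, absorbs the correction term of \<open>log_deriv_recursion\<close>.
\<close>
definition F_sign :: "nat \<Rightarrow> complex" where
  "F_sign s = (if s = 0 then -1 else -2 * (-1) ^ s)"

lemma DERIV_poly_inverse_one_minus:
  fixes z :: complex
  assumes "z \<noteq> 1"
  shows "((\<lambda>z. poly p (1 / (1 - z))) has_field_derivative
     (1 / (1 - z))\<^sup>2 * poly (pderiv p) (1 / (1 - z))) (at z)"
proof -
  have "((\<lambda>z. 1 / (1 - z)) has_field_derivative (1 / (1 - z))\<^sup>2) (at z)"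
    using assms by (auto intro!: derivative_eq_intros simp: field_simps power2_eq_square)
  from DERIV_chain2[OF poly_DERIV this] show ?thesis by (simp add: mult.commute)
qed

text \<open>
  In the variable \<open>y = 1 / (1 - z)\<close> one has \<open>z / (1 - z) = y - 1\<close> and \<open>d/dz = y\<^sup>2 d/dy\<close>, so both recursions
  have the same derivative term.  The convolutions agree after separating the two end terms.
\<close>
lemma F_minus_eq_poly:
  assumes "z \<noteq> 1"
  shows "F_minus s z = F_sign s * poly (log_deriv s) (1 / (1 - z))"
  using assms
proof (induction s arbitrary: z rule: less_induct)
  case (less s)
  define y where "y = 1 / (1 - z)"
  have z: "z \<noteq> 1" "1 - z \<noteq> 0" "z - 1 \<noteq> 0" using less.prems by auto
  have y0: "y \<noteq> 0" using z by (simp add: y_def)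
  have zy: "z = 1 - 1 / y" "z - 1 = - (1 / y)" using z by (simp_all add: y_def)
  have zy2: "z / (1 - z) = y - 1" using z by (simp add: y_def field_simps)
  consider "s = 0" | "s = 1" | k where "s = Suc (Suc k)"
    by (metis One_nat_def not0_implies_Suc)
  thus ?case
  proof cases
    case 1
    have "- (z / (z - 1)\<^sup>2) = - (y * (y - 1))"
      unfolding zy(2) using y0 by (simp add: zy(1) field_simps power2_eq_square)
    thus ?thesis using 1 by (simp add: F_sign_def poly_log_deriv_0 y_def[symmetric])
  next
    case 2
    have "poly (log_deriv (Suc 0)) y = - (y\<^sup>2 * (y - 1) * (2 * y - 1))"
      unfolding log_deriv_recursion by (simp add: log_deriv_coeff_def expo_deriv.simps(1) pderiv_pCons)
    moreover have "- (2 * z * (z + 1) / (z - 1) ^ 4) = - (2 * (y\<^sup>2 * (y - 1) * (2 * y - 1)))"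
      unfolding zy(2) using y0 by (simp add: zy(1) field_simps power2_eq_square eval_nat_numeral)
    ultimately show ?thesis using 2 by (simp add: F_sign_def y_def[symmetric])
  next
    case 3
    define c where "c = F_sign (Suc k)"
    let ?w = "\<lambda>j. poly (log_deriv j) y"
    have "(F_minus (Suc k) has_field_derivative
        c * (y\<^sup>2 * poly (pderiv (log_deriv (Suc k))) y)) (at z)"
    proof (rule has_field_derivative_transform_within_open[where S = "- {1}"])
      show "((\<lambda>z. c * poly (log_deriv (Suc k)) (1 / (1 - z))) has_field_derivative
        c * (y\<^sup>2 * poly (pderiv (log_deriv (Suc k))) y)) (at z)"
        unfolding y_def by (rule DERIV_cmult[OF DERIV_poly_inverse_one_minus[OF z(1)]])
    qed (use z less.IH[of "Suc k"] 3 in \<open>auto simp: c_def\<close>)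
    hence d: "deriv (F_minus (Suc k)) z = c * (y\<^sup>2 * poly (pderiv (log_deriv (Suc k))) y)"
      by (rule DERIV_imp_deriv)
    have IH: "F_minus j z = F_sign j * ?w j" if "j \<le> Suc k" for j
      using less.IH[of j] that 3 z by (simp add: y_def)
    have split: "(\<Sum>j=0..Suc k. g j) = g 0 + (\<Sum>j=1..k. g j) + g (Suc k)" for g :: "nat \<Rightarrow> complex"
      by (simp add: sum.atLeast_Suc_atMost)
    have mid: "(\<Sum>j=1..k. F_minus j z * F_minus (Suc k - j) z)
        = - 2 * c * (\<Sum>j=1..k. ?w j * ?w (Suc k - j))"
      unfolding sum_distrib_left
    proof (rule sum.cong)
      fix j assume j: "j \<in> {1..k}"
      have "F_sign j * F_sign (Suc k - j) = - 2 * c"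
        using j power_add[of "-1 :: complex" j "Suc k - j"] by (simp add: F_sign_def c_def)
      moreover have "F_minus j z * F_minus (Suc k - j) z
          = (F_sign j * F_sign (Suc k - j)) * (?w j * ?w (Suc k - j))"
        using j by (simp add: IH mult_ac)
      ultimately show "F_minus j z * F_minus (Suc k - j) z = - 2 * c * (?w j * ?w (Suc k - j))"
        by simp
    qed simp
    have ends: "F_minus 0 z * F_minus (Suc k - 0) z = - c * ?w 0 * ?w (Suc k)"
        "F_minus (Suc k) z * F_minus (Suc k - Suc k) z = - c * ?w 0 * ?w (Suc k)"
      using IH[of 0] IH[of "Suc k"] by (simp_all add: c_def F_sign_def del: F_minus.simps)
    have "F_minus s z = (y - 1) * (c * (y\<^sup>2 * poly (pderiv (log_deriv (Suc k))) y))
        + c * (\<Sum>j=1..k. ?w j * ?w (Suc k - j)) + c * ?w 0 * ?w (Suc k)"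
      unfolding 3 F_minus.simps(3) d zy2 split mid using ends
      by (simp add: algebra_simps del: F_minus.simps)
    also have "\<dots> = - c * ?w (Suc (Suc k))"
      unfolding log_deriv_recursion[of "Suc k"] split by (simp add: algebra_simps)
    also have "- c = F_sign s" by (simp add: 3 c_def F_sign_def)
    finally show ?thesis using 3 by (simp add: y_def del: F_minus.simps)
  qed
qed

section \<open>The truncated exponent and its residual\<close>

lemma pderiv_sum: "pderiv (\<Sum>i\<in>A. f i) = (\<Sum>i\<in>A. pderiv (f i))"
  by (induction A rule: infinite_finite_induct) (simp_all add: pderiv_add)

lemma ex_poly_primitive: "\<exists>q. pderiv q = p \<and> poly q 1 = (0 :: complex)"
proof -
  define q where "q = (\<Sum>i\<le>degree p. monom (coeff p i / of_nat (Suc i)) (Suc i))"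
  have "pderiv q = (\<Sum>i\<le>degree p. monom (coeff p i) i)"
    unfolding q_def pderiv_sum pderiv_monom
    by (intro sum.cong) (auto simp del: of_nat_Suc)
  also have "\<dots> = p" by (rule poly_as_sum_of_monoms)
  finally have "pderiv (q - [:poly q 1:]) = p"
    by (simp add: pderiv_diff pderiv_pCons)
  moreover have "poly (q - [:poly q 1:]) 1 = 0" by simp
  ultimately show ?thesis by blast
qed

text \<open>The condition at \<open>y = 1\<close>, that is \<open>z = 0\<close>, is the normalisation \<open>E\<^sub>s(0) = 0\<close>.\<close>
definition expo_coeff :: "nat \<Rightarrow> complex poly" where
  "expo_coeff k = (SOME q. pderiv q = expo_deriv k \<and> poly q 1 = 0)"

lemma pderiv_expo_coeff: "pderiv (expo_coeff k) = expo_deriv k" and poly_expo_coeff_1: "poly (expo_coeff k) 1 = 0"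
  using someI_ex[OF ex_poly_primitive[of "expo_deriv k"]] unfolding expo_coeff_def by auto

text \<open>
  Since \<open>(t - 1) / t = - 1 / (y - 1)\<close>, the factor \<open>y - 1\<close> of \<open>F_minus\<close> cancels and the integrand becomes
  \<open>y\<^sup>2\<close> times \<open>expo_deriv s\<close>, the \<open>t\<close>-derivative of a polynomial in \<open>y\<close>.  For \<open>\<theta> = 0\<close> the segment is
  degenerate and is treated separately.
\<close>
lemma E_minus_eq_poly:
  assumes "s \<ge> 1" "\<theta> \<ge> 0"
  shows "E_minus s (- (\<i> * of_real \<theta>)) = (-1) ^ s * poly (expo_coeff s) (1 / (1 + \<i> * of_real \<theta>))"
proof (cases "\<theta> = 0")
  case True
  thus ?thesis by (simp add: E_minus_def poly_expo_coeff_1)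
next
  case False
  let ?z = "- (\<i> * of_real \<theta>)" and ?S = "{t :: complex. Re t = 0}"
  let ?h = "\<lambda>t. (-1) ^ s * ((1 / (1 - t))\<^sup>2 * poly (expo_deriv s) (1 / (1 - t)))"
  obtain k where k: "s = Suc k" using assms by (cases s) auto
  have seg: "path_image (linepath 0 ?z) \<subseteq> ?S"
    by (auto simp: closed_segment_def)
  have "E_minus s ?z = contour_integral (linepath 0 ?z) ?h"
    unfolding E_minus_def
  proof (rule contour_integral_spike_finite_simple_path[of "{0}"])
    show "simple_path (linepath 0 ?z)" using False by (intro simple_path_linepath) auto
    fix t assume "t \<in> path_image (linepath 0 ?z) - {0}"
    hence t: "t \<noteq> 0" "t \<noteq> 1" "1 - t \<noteq> 0" using seg by auto
    have "(t - 1) * (1 / (1 - t) - 1) = - t"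
      using t by (simp add: field_simps)
    hence "(t - 1) * (c * (u * (1 / (1 - t) - 1) * v)) / (2 * t) = - (c / 2) * (u * v)" for c u v
      using t by (simp add: field_simps)
    thus "(t - 1) * F_minus s t / (2 * t) = ?h t"
      unfolding F_minus_eq_poly[OF t(2)] k poly_log_deriv_Suc by (simp add: F_sign_def)
  qed auto
  also have "\<dots> = (-1) ^ s * poly (expo_coeff s) (1 / (1 - pathfinish (linepath 0 ?z)))
      - (-1) ^ s * poly (expo_coeff s) (1 / (1 - pathstart (linepath 0 ?z)))"
  proof (rule contour_integral_unique, rule contour_integral_primitive[where S = ?S])
    fix t assume "t \<in> ?S"
    hence "t \<noteq> 1" by auto
    from DERIV_cmult[OF DERIV_poly_inverse_one_minus[OF this, of "expo_coeff s"], of "(-1) ^ s"]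
    show "((\<lambda>t. (-1) ^ s * poly (expo_coeff s) (1 / (1 - t))) has_field_derivative ?h t) (at t within ?S)"
      unfolding pderiv_expo_coeff by (rule has_field_derivative_at_within)
  qed (use seg in \<open>auto simp del: linepath_0\<close>)
  finally show ?thesis by (simp add: poly_expo_coeff_1)
qed

definition expo_sum :: "nat \<Rightarrow> complex \<Rightarrow> complex poly" where
  "expo_sum N \<epsilon> = (\<Sum>k=1..N. smult (\<epsilon> ^ k) (expo_coeff k))"

lemma poly_expo_sum: "poly (expo_sum N \<epsilon>) y = (\<Sum>k=1..N. \<epsilon> ^ k * poly (expo_coeff k) y)"
  by (simp add: expo_sum_def poly_sum)

text \<open>
  The factor left over when \<open>e\<^sup>S (1 + \<epsilon> P)\<close> is differentiated in \<open>y\<close> and \<open>e\<^sup>S\<close> is divided out.  It vanishes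
  identically when \<open>y e\<^sup>s\<close> satisfies the first order equation up to a constant factor on the right.
\<close>
definition resid_poly :: "complex poly \<Rightarrow> complex \<Rightarrow> complex poly" where
  "resid_poly s \<epsilon> = pderiv s * (1 + smult \<epsilon> (log_deriv_coeff 0 (pderiv s)))
     + smult \<epsilon> (pderiv (log_deriv_coeff 0 (pderiv s)))"

text \<open>
  The left-hand side is \<open>dS/dy (1 + \<epsilon> P) + \<epsilon> dP/dy\<close> for truncated series.  The recursion annihilates
  the coefficients of \<open>\<epsilon>\<^sup>0, \<dots>, \<epsilon>\<^sup>N\<close>; what survives are the products of total order above \<open>N\<close> and the first
  omitted coefficient.
\<close>
lemma truncated_recursion:
  fixes d w w' :: "nat \<Rightarrow> 'a :: comm_ring_1"
  assumes d0: "d 0 = 0" and rec: "\<And>m. d (Suc m) = - w' m - (\<Sum>j=0..m. d j * w (m - j))"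
  shows "(\<Sum>k\<le>N. \<epsilon> ^ k * d k) * (1 + \<epsilon> * (\<Sum>k\<le>N. \<epsilon> ^ k * w k)) + \<epsilon> * (\<Sum>k\<le>N. \<epsilon> ^ k * w' k)
    = \<epsilon> ^ (N + 1) * ((\<Sum>j\<le>N. \<Sum>k\<in>{N-j<..N}. \<epsilon> ^ (j + k - N) * (d j * w k)) - d (Suc N))"
proof -
  let ?f = "\<lambda>j k. \<epsilon> ^ (j + k) * (d j * w k)"
  have "(\<Sum>k\<le>N. \<epsilon> ^ k * d k) * (\<Sum>k\<le>N. \<epsilon> ^ k * w k) = (\<Sum>j\<le>N. \<Sum>k\<le>N. ?f j k)"
    by (simp add: sum_product power_add mult_ac)
  also have "\<dots> = (\<Sum>j\<le>N. (\<Sum>k\<le>N-j. ?f j k) + (\<Sum>k\<in>{N-j<..N}. ?f j k))"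
  proof (intro sum.cong refl)
    fix j
    have "{..N} = {..N-j} \<union> {N-j<..N}" by auto
    thus "(\<Sum>k\<le>N. ?f j k) = (\<Sum>k\<le>N-j. ?f j k) + (\<Sum>k\<in>{N-j<..N}. ?f j k)"
      by (metis (no_types, lifting) finite_atMost finite_greaterThanAtMost ivl_disj_int_one(3) sum.union_disjoint)
  qed
  also have "\<dots> = (\<Sum>m\<le>N. \<Sum>j\<le>m. ?f j (m - j)) + (\<Sum>j\<le>N. \<Sum>k\<in>{N-j<..N}. ?f j k)"
  proof -
    have "{(i, j). i + j \<le> N} = (SIGMA i:{..N}. {..N-i})" by auto
    thus ?thesis unfolding sum.distrib sum.triangle_reindex_eq[of ?f N, symmetric]
      by (simp add: sum.Sigma)
  qed
  also have "(\<Sum>j\<le>N. \<Sum>k\<in>{N-j<..N}. ?f j k)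
     = \<epsilon> ^ N * (\<Sum>j\<le>N. \<Sum>k\<in>{N-j<..N}. \<epsilon> ^ (j + k - N) * (d j * w k))"
    unfolding sum_distrib_left
    by (intro sum.cong refl) (auto simp: mult.assoc[symmetric] power_add[symmetric])
  also have "(\<Sum>m\<le>N. \<Sum>j\<le>m. ?f j (m - j)) = (\<Sum>m\<le>N. \<epsilon> ^ m * (- w' m - d (Suc m)))"
    unfolding rec by (intro sum.cong refl) (auto simp: sum_distrib_left atMost_atLeast0)
  finally have 1: "(\<Sum>k\<le>N. \<epsilon> ^ k * d k) * (\<Sum>k\<le>N. \<epsilon> ^ k * w k) =
     (\<Sum>m\<le>N. \<epsilon> ^ m * (- w' m - d (Suc m)))
     + \<epsilon> ^ N * (\<Sum>j\<le>N. \<Sum>k\<in>{N-j<..N}. \<epsilon> ^ (j + k - N) * (d j * w k))" .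
  have 2: "\<epsilon> * (\<Sum>m\<le>N. \<epsilon> ^ m * (- w' m - d (Suc m)))
      = - \<epsilon> * (\<Sum>k\<le>N. \<epsilon> ^ k * w' k) - (\<Sum>m\<le>N. \<epsilon> ^ Suc m * d (Suc m))"
    by (simp add: sum_subtractf sum_negf right_diff_distrib sum_distrib_left mult_ac)
  have 3: "(\<Sum>m\<le>N. \<epsilon> ^ Suc m * d (Suc m)) = (\<Sum>k\<le>N. \<epsilon> ^ k * d k) + \<epsilon> ^ Suc N * d (Suc N)"
    using sum.atMost_Suc_shift[of "\<lambda>k. \<epsilon> ^ k * d k" N] sum.atMost_Suc[of "\<lambda>k. \<epsilon> ^ k * d k" N]
    by (simp add: d0)
  let ?R = "(\<Sum>j\<le>N. \<Sum>k\<in>{N-j<..N}. \<epsilon> ^ (j + k - N) * (d j * w k))"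
  have "(\<Sum>k\<le>N. \<epsilon> ^ k * d k) * (1 + \<epsilon> * (\<Sum>k\<le>N. \<epsilon> ^ k * w k))
    = (\<Sum>k\<le>N. \<epsilon> ^ k * d k) + \<epsilon> * ((\<Sum>k\<le>N. \<epsilon> ^ k * d k) * (\<Sum>k\<le>N. \<epsilon> ^ k * w k))"
    by (simp add: algebra_simps)
  also have "\<epsilon> * ((\<Sum>k\<le>N. \<epsilon> ^ k * d k) * (\<Sum>k\<le>N. \<epsilon> ^ k * w k))
    = \<epsilon> * (\<Sum>m\<le>N. \<epsilon> ^ m * (- w' m - d (Suc m))) + \<epsilon> ^ (N + 1) * ?R"
    unfolding 1 by (simp add: distrib_left mult.assoc)
  finally show ?thesis unfolding 2 3 by (simp add: algebra_simps)
qed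

text \<open>Writing the power \<open>\<epsilon>\<^sup>N\<^sup>+\<^sup>1\<close> as an explicit factor leaves a cofactor that is continuous in \<open>(\<epsilon>, y)\<close>.\<close>
lemma poly_resid_expo_sum:
  "poly (resid_poly (expo_sum N \<epsilon>) \<epsilon>) y = \<epsilon> ^ (N + 1) *
     ((\<Sum>j\<le>N. \<Sum>k\<in>{N-j<..N}. \<epsilon> ^ (j + k - N) * (poly (expo_deriv j) y * poly (log_deriv k) y)) - poly (expo_deriv (Suc N)) y)"
proof -
  have split: "(\<Sum>k\<le>N. g k) = g 0 + (\<Sum>k=1..N. g k)" for g :: "nat \<Rightarrow> complex poly"
    by (simp add: atMost_atLeast0 sum.atLeast_Suc_atMost)
  have d: "pderiv (expo_sum N \<epsilon>) = (\<Sum>k\<le>N. smult (\<epsilon> ^ k) (expo_deriv k))"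
    unfolding split by (simp add: expo_sum_def pderiv_sum pderiv_smult pderiv_expo_coeff expo_deriv.simps(1))
  have w: "log_deriv_coeff 0 (pderiv (expo_sum N \<epsilon>)) = (\<Sum>k\<le>N. smult (\<epsilon> ^ k) (log_deriv k))"
  proof -
    have "(\<Sum>k=1..N. smult (\<epsilon> ^ k) (log_deriv k)) = [:0, 0, -1, 1:] * (\<Sum>k=1..N. smult (\<epsilon> ^ k) (expo_deriv k))"
      by (simp add: log_deriv_coeff_def sum_distrib_left)
    thus ?thesis unfolding d split by (simp add: log_deriv_coeff_def expo_deriv.simps(1))
  qed
  show ?thesis
    unfolding resid_poly_def w pderiv_sum unfolding d
    using truncated_recursion[of "\<lambda>k. poly (expo_deriv k) y" "\<lambda>k. poly (pderiv (log_deriv k)) y" "\<lambda>k. poly (log_deriv k) y" \<epsilon> N]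
    by (simp add: poly_sum pderiv_smult expo_deriv.simps)
qed

text \<open>
  The cofactor is bounded because \<open>(\<epsilon>, y)\<close> ranges over the compact set \<open>[0, 1] \<times>\<close> unit disc.
  All uniformity in \<open>\<theta>\<close> comes from here and from \<open>expo_sum_bound\<close>.
\<close>
lemma exp_resid_bound:
  "\<exists>C. \<forall>\<epsilon>\<in>{0..1}. \<forall>y\<in>cball 0 1.
     norm (exp (poly (expo_sum N (of_real \<epsilon>)) y) * poly (resid_poly (expo_sum N (of_real \<epsilon>)) (of_real \<epsilon>)) y)
       \<le> C * \<epsilon> ^ (N + 1)"
proof -
  define r :: "real \<times> complex \<Rightarrow> complex" where
    "r = (\<lambda>(\<epsilon>, y). exp (poly (expo_sum N (of_real \<epsilon>)) y) *
      ((\<Sum>j\<le>N. \<Sum>k\<in>{N-j<..N}. of_real \<epsilon> ^ (j + k - N) * (poly (expo_deriv j) y * poly (log_deriv k) y)) - poly (expo_deriv (Suc N)) y))"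
  have "compact (({0..1} :: real set) \<times> cball (0 :: complex) 1)"
    by (intro compact_Times) auto
  moreover have "continuous_on ({0..1} \<times> cball 0 1) r"
    unfolding r_def poly_expo_sum case_prod_unfold by (intro continuous_intros)
  ultimately have "bounded (r ` ({0..1} \<times> cball 0 1))"
    by (intro compact_imp_bounded compact_continuous_image)
  then obtain C where C: "\<And>p. p \<in> {0..1} \<times> cball 0 1 \<Longrightarrow> norm (r p) \<le> C"
    unfolding bounded_iff by auto
  show ?thesis
  proof (intro exI ballI)
    fix \<epsilon> y :: _ assume *: "\<epsilon> \<in> {0..1::real}" "y \<in> cball (0::complex) 1"
    have "exp (poly (expo_sum N (of_real \<epsilon>)) y) * poly (resid_poly (expo_sum N (of_real \<epsilon>)) (of_real \<epsilon>)) y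
       = of_real (\<epsilon> ^ (N + 1)) * r (\<epsilon>, y)"
      unfolding poly_resid_expo_sum by (simp add: r_def mult_ac)
    thus "norm (exp (poly (expo_sum N (of_real \<epsilon>)) y) * poly (resid_poly (expo_sum N (of_real \<epsilon>)) (of_real \<epsilon>)) y)
       \<le> C * \<epsilon> ^ (N + 1)"
      using * mult_left_mono[OF C[of "(\<epsilon>, y)"], of "\<epsilon> ^ (N + 1)"]
      by (simp add: norm_mult norm_power mult_ac)
  qed
qed

lemma expo_sum_bound:
  "\<exists>C. \<forall>\<epsilon>\<in>{0..1}. \<forall>y\<in>cball 0 1. norm (poly (expo_sum N (of_real \<epsilon>)) y) \<le> C * \<epsilon>"
proof -
  have "\<exists>C. \<forall>y\<in>cball 0 1. norm (poly (expo_coeff k) y) \<le> C" for k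
  proof -
    have "bounded (poly (expo_coeff k) ` cball 0 1)"
      by (intro compact_imp_bounded compact_continuous_image continuous_intros) auto
    thus ?thesis unfolding bounded_iff by auto
  qed
  then obtain C where C: "\<And>k y. y \<in> cball 0 1 \<Longrightarrow> norm (poly (expo_coeff k) y) \<le> C k" by metis
  show ?thesis
  proof (intro exI[of _ "\<Sum>k=1..N. C k"] ballI)
    fix \<epsilon> :: real and y :: complex assume *: "\<epsilon> \<in> {0..1}" "y \<in> cball 0 1"
    have "norm (poly (expo_sum N (of_real \<epsilon>)) y) \<le> (\<Sum>k=1..N. C k * \<epsilon>)"
      unfolding poly_expo_sum
    proof (rule sum_norm_le)
      fix k assume k: "k \<in> {1..N}"
      have "\<epsilon> ^ k \<le> \<epsilon> ^ 1" using * k by (intro power_decreasing) auto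
      hence "\<epsilon> ^ k * norm (poly (expo_coeff k) y) \<le> \<epsilon> * C k"
        using * by (intro mult_mono C) auto
      thus "norm (of_real \<epsilon> ^ k * poly (expo_coeff k) y) \<le> C k * \<epsilon>"
        using * by (simp add: norm_mult norm_power mult_ac)
    qed
    thus "norm (poly (expo_sum N (of_real \<epsilon>)) y) \<le> (\<Sum>k=1..N. C k) * \<epsilon>"
      by (simp add: sum_distrib_right)
  qed
qed

section \<open>Integration by parts against an approximate solution\<close>

definition osc :: "real \<Rightarrow> real \<Rightarrow> complex" where
  "osc a z = integral {0..z} (\<lambda>t. of_real (t powr (a - 1)) * cis t)"

lemma powr_cis_deriv:
  assumes "t > 0"
  shows "((\<lambda>t. of_real (t powr a) * cis t) has_vector_derivative
     (of_real a / of_real t + \<i>) * (of_real (t powr a) * cis t)) (at t)"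
proof -
  have 1: "((\<lambda>t. t powr a) has_real_derivative a * t powr (a - 1)) (at t)"
    using assms by (rule has_real_derivative_powr)
  have 2: "(cis has_vector_derivative \<i> * cis t) (at t)"
    unfolding cis_conv_exp
    by (rule has_vector_derivative_real_field derivative_eq_intros | simp)+
  have "t powr (a - 1) = t powr a / t" using assms by (simp add: powr_diff)
  thus ?thesis
    using has_vector_derivative_mult[OF has_vector_derivative_of_real[OF 1] 2]
    by (simp add: algebra_simps)
qed

lemma continuous_on_powr_cis [continuous_intros]:
  assumes "a > 0"
  shows "continuous_on {0..z} (\<lambda>t. of_real (t powr a) * cis t)"
  using assms by (intro continuous_intros continuous_on_powr') auto

text \<open>
  For \<open>a < 1\<close> the integrand is unbounded at \<open>0\<close>.  The function \<open>t\<^sup>a e\<^sup>i\<^sup>t\<close> is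
  continuous there, and its derivative differs from \<open>a t\<^sup>a\<^sup>-\<^sup>1 e\<^sup>i\<^sup>t\<close> by the continuous function \<open>i t\<^sup>a e\<^sup>i\<^sup>t\<close>.
\<close>
lemma osc_integrable:
  assumes "a > 0" "z \<ge> 0"
  shows "(\<lambda>t. of_real (t powr (a - 1)) * cis t) integrable_on {0..z}"
proof -
  let ?v = "\<lambda>t. of_real (t powr a) * cis t"
  have "((\<lambda>t. (of_real a / of_real t + \<i>) * ?v t) has_integral ?v z - ?v 0) {0..z}"
    using assms by (intro fundamental_theorem_of_calculus_interior powr_cis_deriv continuous_intros) auto
  moreover have "(\<lambda>t. \<i> * ?v t) integrable_on {0..z}"
    using assms by (intro integrable_continuous_real continuous_intros)
  ultimately have "(\<lambda>t. (of_real a / of_real t + \<i>) * ?v t - \<i> * ?v t) integrable_on {0..z}"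
    by (intro integrable_diff) auto
  hence "(\<lambda>t. ((of_real a / of_real t + \<i>) * ?v t - \<i> * ?v t) / of_real a) integrable_on {0..z}"
    by (rule integrable_on_divide)
  thus ?thesis
  proof (rule integrable_eq)
    fix t assume "t \<in> {0..z}"
    thus "((of_real a / of_real t + \<i>) * ?v t - \<i> * ?v t) / of_real a = of_real (t powr (a - 1)) * cis t"
      using assms by (cases "t = 0") (auto simp: powr_diff field_simps)
  qed
qed

lemma gen_Ci_eq_Re_osc: "a > 0 \<Longrightarrow> z \<ge> 0 \<Longrightarrow> gen_Ci a z = Re (osc a z)"
  and gen_Si_eq_Im_osc: "a > 0 \<Longrightarrow> z \<ge> 0 \<Longrightarrow> gen_Si a z = Im (osc a z)"
proof -
  assume "a > 0" "z \<ge> 0"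
  hence *: "((\<lambda>t. of_real (t powr (a - 1)) * cis t) has_integral osc a z) {0..z}"
    unfolding osc_def by (intro integrable_integral osc_integrable)
  show "gen_Ci a z = Re (osc a z)" "gen_Si a z = Im (osc a z)"
    using has_integral_Re[OF *] has_integral_Im[OF *]
    by (simp_all add: gen_Ci_def gen_Si_def integral_unique)
qed

text \<open>
  \<open>y e\<^sup>s\<close> solves \<open>\<epsilon> z h' + (1 - z) h = 1 - defect\<close>, so a vanishing defect means an exact solution.
\<close>
definition defect :: "complex poly \<Rightarrow> complex \<Rightarrow> complex \<Rightarrow> complex" where
  "defect s \<epsilon> y = 1 - exp (poly s y) * (1 + \<epsilon> * poly (log_deriv_coeff 0 (pderiv s)) y)"

lemma DERIV_defect:
  "(defect s \<epsilon> has_field_derivative - (exp (poly s y) * poly (resid_poly s \<epsilon>) y)) (at y)"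
  unfolding defect_def[abs_def] resid_poly_def
  by (auto intro!: derivative_eq_intros simp: algebra_simps)

text \<open>The derivative of \<open>y * defect s \<epsilon> y\<close>.\<close>
definition times_defect_deriv :: "complex poly \<Rightarrow> complex \<Rightarrow> complex \<Rightarrow> complex" where
  "times_defect_deriv s \<epsilon> y = defect s \<epsilon> y - y * (exp (poly s y) * poly (resid_poly s \<epsilon>) y)"

text \<open>
  Let \<open>K = y e\<^sup>s + y defect\<close>.  The first summand solves the first order equation up to the
  defect, and the second repairs the algebraic part \<open>(1 - z) h\<close> of the equation exactly, at the cost of
  a term that contains only the derivative of \<open>y defect\<close>.  Hence \<open>t\<^sup>a e\<^sup>i\<^sup>t K(y(t))\<close> has the derivative
  \<open>a t\<^sup>a\<^sup>-\<^sup>1 e\<^sup>i\<^sup>t\<close> plus this term, and \<open>a J\<close> equals a boundary term plus a small integral.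
  The correction is what makes the estimate below survive multiplication by
  \<open>1 + i\<theta>\<close>: the derivative brings a factor \<open>y\<^sup>2\<close>, which decays like \<open>t\<^sup>-\<^sup>2\<close>.
\<close>
lemma osc_by_parts:
  fixes a z :: real and s :: "complex poly"
  assumes a: "a > 0" and z: "z \<ge> 0"
  defines "\<epsilon> \<equiv> 1 / of_real a :: complex"
  defines "y \<equiv> \<lambda>t::real. 1 / (1 + \<i> * \<epsilon> * of_real t)"
  shows "((\<lambda>t. of_real (t powr a) * cis t * (times_defect_deriv s \<epsilon> (y t) * (\<i> * \<epsilon> * (y t)\<^sup>2)))
      has_integral of_real a * osc a z
         - of_real (z powr a) * cis z * (y z * (exp (poly s (y z)) + defect s \<epsilon> (y z)))) {0..z}"
proof -
  let ?v = "\<lambda>t. of_real (t powr a) * cis t"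
  let ?K = "\<lambda>y. y * (exp (poly s y) + defect s \<epsilon> y)"
  let ?K' = "\<lambda>y. (exp (poly s y) + y * (poly (pderiv s) y * exp (poly s y))) + times_defect_deriv s \<epsilon> y"
  let ?g = "\<lambda>t. of_real a * (of_real (t powr (a - 1)) * cis t) - ?v t * (times_defect_deriv s \<epsilon> (y t) * (\<i> * \<epsilon> * (y t)\<^sup>2))"
  have nz: "1 + \<i> * \<epsilon> * of_real t \<noteq> 0" for t :: real
    by (auto simp: complex_eq_iff \<epsilon>_def)
  \<comment> \<open>\<open>?K'\<close> keeps the part coming from \<open>y * defect\<close> separate: it alone survives in the integrand.\<close>
  have K: "(?K has_field_derivative ?K' y) (at y)" for y
    unfolding times_defect_deriv_def by (auto intro!: derivative_eq_intros DERIV_defect simp: algebra_simps)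
  have y: "(y has_vector_derivative - (\<i> * \<epsilon> * (y t)\<^sup>2)) (at t)" for t
  proof -
    have "((\<lambda>t. 1 / (1 + \<i> * \<epsilon> * t)) has_field_derivative - (\<i> * \<epsilon> * (y t)\<^sup>2)) (at (of_real t))"
      using nz[of t] by (auto intro!: derivative_eq_intros simp: y_def power2_eq_square)
    thus ?thesis unfolding y_def by (rule has_vector_derivative_real_field)
  qed
  have Ky: "((\<lambda>t. ?K (y t)) has_vector_derivative - (\<i> * \<epsilon> * (y t)\<^sup>2) * ?K' (y t)) (at t)" for t
    using field_vector_diff_chain_at[OF y K] by (simp add: o_def)
  have g: "(?g has_integral ?v z * ?K (y z) - ?v 0 * ?K (y 0)) {0..z}"
  proof (rule fundamental_theorem_of_calculus_interior[OF z])
    have "continuous_on {0..z} (\<lambda>t. ?K (y t))"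
      by (intro continuous_at_imp_continuous_on ballI has_vector_derivative_continuous[OF Ky])
    thus "continuous_on {0..z} (\<lambda>t. ?v t * ?K (y t))"
      by (rule continuous_on_mult[OF continuous_on_powr_cis[OF a]])
  next
    fix t assume "t \<in> {0<..<z}"
    hence t: "t > 0" by simp
    define Y where "Y = y t"
    define E where "E = exp (poly s Y)"
    have Y0: "Y \<noteq> 0" using nz by (simp add: Y_def y_def)
    have iet: "\<i> * \<epsilon> * of_real t = 1 / Y - 1" by (simp add: Y_def y_def)
    have ai: "of_real a / of_real t + \<i> = of_real a / of_real t * (1 / Y)"
      unfolding Y_def y_def using a t by (simp add: \<epsilon>_def field_simps)
    have ie: "\<i> * \<epsilon> * Y\<^sup>2 = Y * (1 - Y) / of_real t"
    proof -
      have "\<i> * \<epsilon> * Y\<^sup>2 * of_real t = (\<i> * \<epsilon> * of_real t) * Y\<^sup>2" by (simp add: mult_ac)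
      also have "\<dots> = Y * (1 - Y)" unfolding iet using Y0 by (simp add: field_simps power2_eq_square)
      finally show ?thesis using t by (simp add: field_simps)
    qed
    have D: "defect s \<epsilon> Y = 1 - E * (1 + \<epsilon> * (Y * (Y - 1) + Y\<^sup>2 * (Y - 1) * poly (pderiv s) Y))"
      unfolding defect_def E_def log_deriv_coeff_def by (simp add: algebra_simps power2_eq_square)
    have ea: "\<epsilon> * of_real a = 1" using a by (simp add: \<epsilon>_def)
    \<comment> \<open>The first order equation: adding \<open>y * defect\<close> to \<open>y * exp s\<close> makes its right-hand side exactly \<open>a\<close>.\<close>
    have "of_real a * (1 / Y) * ?K Y
       - Y * (1 - Y) * (E + Y * (poly (pderiv s) Y * E))
       = of_real a - of_real a * \<epsilon> * (E * (Y * (Y - 1) + Y\<^sup>2 * (Y - 1) * poly (pderiv s) Y))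
         - Y * (1 - Y) * (E + Y * (poly (pderiv s) Y * E))"
      using Y0 unfolding D E_def[symmetric] by (simp add: algebra_simps)
    also have "\<dots> = of_real a"
      using ea by (simp add: mult.commute algebra_simps power2_eq_square)
    finally have key: "of_real a * (1 / Y) * ?K Y - Y * (1 - Y) * (E + Y * (poly (pderiv s) Y * E)) = of_real a" .
    have alg: "v * (- (q / \<tau>) * (A + B)) + c / \<tau> * i * v * K
        = v / \<tau> * (c * i * K - q * A) - v * (B * (q / \<tau>))" for v q \<tau> A B c i K :: complex
      by (simp add: algebra_simps add_divide_distrib diff_divide_distrib)
    have p: "of_real (t powr (a - 1)) = of_real (t powr a) / (of_real t :: complex)"
      using t by (simp add: powr_diff)
    have "((\<lambda>t. ?v t * ?K (y t)) has_vector_derivative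
       ?v t * (- (\<i> * \<epsilon> * (y t)\<^sup>2) * ?K' (y t)) + (of_real a / of_real t + \<i>) * ?v t * ?K (y t)) (at t)"
      by (rule has_vector_derivative_mult[OF powr_cis_deriv[OF t] Ky])
    also have "?v t * (- (\<i> * \<epsilon> * (y t)\<^sup>2) * ?K' (y t)) + (of_real a / of_real t + \<i>) * ?v t * ?K (y t)
       = ?v t / of_real t * (of_real a * (1 / Y) * ?K Y - Y * (1 - Y) * (E + Y * (poly (pderiv s) Y * E)))
         - ?v t * (times_defect_deriv s \<epsilon> Y * (\<i> * \<epsilon> * Y\<^sup>2))"
      unfolding Y_def[symmetric] E_def[symmetric] ai ie by (rule alg)
    also have "\<dots> = ?g t"
      unfolding key p Y_def[symmetric] by simp
    finally show "((\<lambda>t. ?v t * ?K (y t)) has_vector_derivative ?g t) (at t)" .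
  qed
  have "((\<lambda>t. of_real a * (of_real (t powr (a - 1)) * cis t)) has_integral of_real a * osc a z) {0..z}"
    unfolding osc_def by (intro has_integral_mult_right integrable_integral osc_integrable a z)
  from has_integral_diff[OF this g] show ?thesis
    using a by simp
qed

section \<open>Uniform approximation of the amplitude factor and its logarithm\<close>

text \<open>The defect vanishes at \<open>y = 1\<close>, and every point of the disc has distance at most \<open>2\<close> from there.\<close>
lemma defect_bound:
  assumes s1: "poly s 1 = 0"
    and k: "\<And>y. y \<in> cball 0 1 \<Longrightarrow> norm (exp (poly s y) * poly (resid_poly s \<epsilon>) y) \<le> \<kappa>"
    and y: "y \<in> cball 0 1"
  shows "norm (defect s \<epsilon> y) \<le> 2 * \<kappa>" "norm (times_defect_deriv s \<epsilon> y) \<le> 3 * \<kappa>"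
proof -
  have k0: "\<kappa> \<ge> 0" by (rule order_trans[OF norm_ge_zero k[OF y]])
  have d1: "defect s \<epsilon> 1 = 0" by (simp add: defect_def log_deriv_coeff_def s1)
  have "norm (defect s \<epsilon> y - defect s \<epsilon> 1) \<le> \<kappa> * norm (y - 1)"
    by (rule field_differentiable_bound[OF convex_cball[of 0 1] has_field_derivative_at_within[OF DERIV_defect]])
      (use k y in auto)
  also have "\<dots> \<le> \<kappa> * 2"
    using norm_triangle_ineq4[of y 1] y k0 by (intro mult_left_mono) auto
  finally show D: "norm (defect s \<epsilon> y) \<le> 2 * \<kappa>" by (simp add: d1)
  have "norm (y * (exp (poly s y) * poly (resid_poly s \<epsilon>) y)) \<le> 1 * \<kappa>"
    unfolding norm_mult[of y] using y by (intro mult_mono k) auto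
  thus "norm (times_defect_deriv s \<epsilon> y) \<le> 3 * \<kappa>"
    unfolding times_defect_deriv_def using D norm_triangle_ineq4[of "defect s \<epsilon> y"] by (smt (verit))
qed

text \<open>The factor \<open>H(a, \<theta>)\<close>, which tends to \<open>1\<close> as \<open>a\<close> grows.\<close>
definition osc_factor :: "real \<Rightarrow> real \<Rightarrow> complex" where
  "osc_factor a \<theta> = of_real a * (1 + \<i> * of_real \<theta>) * osc a (a * \<theta>) / (of_real ((a * \<theta>) powr a) * cis (a * \<theta>))"

text \<open>
  The integrand left by the integration by parts is dominated by its value at the right end point.
  For \<open>a \<ge> 2\<close> the quotient is a product of the increasing functions \<open>t\<^sup>a\<^sup>-\<^sup>2\<close> and \<open>t\<^sup>2 / (1 + (t/a)\<^sup>2)\<close>.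
\<close>
lemma powr_quot_mono:
  fixes a x t :: real
  assumes "a \<ge> 2" "0 \<le> t" "t \<le> x"
  shows "t powr a / (1 + (t / a)\<^sup>2) \<le> x powr a / (1 + (x / a)\<^sup>2)"
proof (cases "t = 0")
  case False
  hence t: "t > 0" "x > 0" using assms by auto
  have sq: "u powr a = u powr (a - 2) * u\<^sup>2" if "u > 0" for u :: real
    using that powr_add[of u "a - 2" 2] by simp
  have "t powr a * (x / a)\<^sup>2 = (t powr (a - 2) * t\<^sup>2) * (x / a)\<^sup>2" using sq t by simp
  also have "\<dots> \<le> (x powr (a - 2) * t\<^sup>2) * (x / a)\<^sup>2"
    using assms by (intro mult_right_mono powr_mono2) auto
  also have "\<dots> = x powr a * (t / a)\<^sup>2" using sq[OF t(2)] by (simp add: power_divide)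
  finally have "t powr a * (x / a)\<^sup>2 \<le> x powr a * (t / a)\<^sup>2" .
  moreover have "t powr a \<le> x powr a" using assms by (intro powr_mono2) auto
  ultimately have "t powr a * (1 + (x / a)\<^sup>2) \<le> x powr a * (1 + (t / a)\<^sup>2)"
    by (simp add: algebra_simps)
  moreover have "p / d \<le> q / e" if "d > 0" "e > 0" "p * e \<le> q * d" for p q d e :: real
    using that by (simp add: field_simps)
  ultimately show ?thesis by (simp add: add_pos_nonneg)
qed simp

lemma norm_one_plus_i: "norm (1 + \<i> * of_real x) = sqrt (1 + x\<^sup>2)"
  by (simp add: cmod_def)

lemma inverse_sqrt_le_1: "1 / sqrt (1 + x\<^sup>2) \<le> 1" for x :: real
proof -
  have "1 / r \<le> 1" if "r \<ge> 1" for r :: real using that by simp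
  from this[of "sqrt (1 + x\<^sup>2)"] show ?thesis by simp
qed

text \<open>
  Of the bound \<open>5 \<kappa>\<close>, the boundary term contributes \<open>2 \<kappa>\<close> through the defect.
  The remaining integral is at most \<open>3 \<kappa> (a\<theta>)\<^sup>a \<theta> / (1 + \<theta>\<^sup>2)\<close>, and the prefactor
  \<open>sqrt (1 + \<theta>\<^sup>2)\<close> still leaves \<open>3 \<kappa>\<close> because \<open>\<theta> \<le> sqrt (1 + \<theta>\<^sup>2)\<close>.
\<close>
lemma osc_factor_approx:
  assumes a: "a \<ge> 2" and th: "\<theta> > 0" and s1: "poly s 1 = 0"
    and k: "\<And>y. y \<in> cball 0 1 \<Longrightarrow> norm (exp (poly s y) * poly (resid_poly s (1 / of_real a)) y) \<le> \<kappa>"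
  shows "norm (osc_factor a \<theta> - exp (poly s (1 / (1 + \<i> * of_real \<theta>)))) \<le> 5 * \<kappa>"
proof -
  define \<epsilon> where "\<epsilon> = 1 / complex_of_real a"
  define y where "y = (\<lambda>t::real. 1 / (1 + \<i> * \<epsilon> * of_real t))"
  define x where "x = a * \<theta>"
  define V where "V = of_real (x powr a) * cis x"
  define I where "I = of_real a * osc a x - V * (y x * (exp (poly s (y x)) + defect s \<epsilon> (y x)))"
  have x: "x > 0" using a th by (simp add: x_def)
  have nV: "norm V = x powr a" by (simp add: V_def norm_mult)
  have V0: "V \<noteq> 0" using nV x by auto
  have k0: "\<kappa> \<ge> 0" using order_trans[OF norm_ge_zero k[of 0]] by simp
  have ny: "norm (y t) = 1 / sqrt (1 + (t / a)\<^sup>2)" for t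
  proof -
    have "1 + \<i> * \<epsilon> * of_real t = 1 + \<i> * of_real (t / a)" by (simp add: \<epsilon>_def)
    thus ?thesis unfolding y_def by (simp only: norm_divide norm_one_plus_i norm_one)
  qed
  have yc: "y t \<in> cball 0 1" for t
    unfolding mem_cball dist_0_norm ny by (rule inverse_sqrt_le_1)
  have yx: "y x = 1 / (1 + \<i> * of_real \<theta>)" using a by (simp add: y_def x_def \<epsilon>_def)
  have int: "((\<lambda>t. of_real (t powr a) * cis t * (times_defect_deriv s \<epsilon> (y t) * (\<i> * \<epsilon> * (y t)\<^sup>2))) has_integral I) (cbox 0 x)"
    using osc_by_parts[of a x s] a x unfolding I_def V_def y_def \<epsilon>_def by simp
  have "norm I \<le> (3 * \<kappa> / a * (x powr a / (1 + (x / a)\<^sup>2))) * measure lborel (cbox 0 x)"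
  proof (rule has_integral_bound[OF _ int])
    fix t assume t: "t \<in> cbox 0 x"
    have "norm (of_real (t powr a) * cis t * (times_defect_deriv s \<epsilon> (y t) * (\<i> * \<epsilon> * (y t)\<^sup>2)))
      = norm (times_defect_deriv s \<epsilon> (y t)) * (1 / a * (t powr a / (1 + (t / a)\<^sup>2)))"
      using a by (simp add: norm_mult norm_power ny \<epsilon>_def norm_divide power_divide mult_ac)
    also have "\<dots> \<le> (3 * \<kappa>) * (1 / a * (x powr a / (1 + (x / a)\<^sup>2)))"
      using a t k0 defect_bound(2)[OF s1 k yc]
      by (intro mult_mono mult_nonneg_nonneg powr_quot_mono) (auto simp: \<epsilon>_def)
    finally show "norm (of_real (t powr a) * cis t * (times_defect_deriv s \<epsilon> (y t) * (\<i> * \<epsilon> * (y t)\<^sup>2)))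
      \<le> 3 * \<kappa> / a * (x powr a / (1 + (x / a)\<^sup>2))" by simp
  qed (use k0 a in auto)
  also have "\<dots> = 3 * \<kappa> * (x powr a) * (\<theta> / (1 + \<theta>\<^sup>2))"
    using x a by (simp add: x_def)
  finally have nI: "norm I \<le> 3 * \<kappa> * (x powr a) * (\<theta> / (1 + \<theta>\<^sup>2))" .
  have "osc_factor a \<theta> = (1 / y x) * (of_real a * osc a x) / V"
    unfolding yx by (simp add: osc_factor_def x_def V_def)
  also have "of_real a * osc a x = I + V * (y x * (exp (poly s (y x)) + defect s \<epsilon> (y x)))"
    by (simp add: I_def)
  also have "(1 / y x) * \<dots> / V = exp (poly s (y x)) + (defect s \<epsilon> (y x) + (1 / y x) * I / V)"
  proof -
    have "1 + \<i> * of_real \<theta> \<noteq> 0" by (auto simp: complex_eq_iff)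
    hence "y x \<noteq> 0" by (simp add: yx)
    thus ?thesis using V0 by (simp add: field_simps)
  qed
  finally have "norm (osc_factor a \<theta> - exp (poly s (y x))) \<le> norm (defect s \<epsilon> (y x)) + norm ((1 / y x) * I / V)"
    using norm_triangle_ineq by simp
  also have "norm (defect s \<epsilon> (y x)) \<le> 2 * \<kappa>"
    using defect_bound(1)[OF s1 k yc] by (simp add: \<epsilon>_def)
  also have "norm ((1 / y x) * I / V) \<le> 3 * \<kappa>"
  proof -
    let ?r = "sqrt (1 + \<theta>\<^sup>2)"
    have r: "?r > 0" "?r * ?r = 1 + \<theta>\<^sup>2" by (auto simp: add_pos_nonneg)
    have "\<theta> \<le> ?r" by (rule real_le_rsqrt) simp
    hence "?r * \<theta> \<le> ?r * ?r" using r by (intro mult_left_mono) auto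
    hence rt: "?r * \<theta> / (1 + \<theta>\<^sup>2) \<le> 1" using r by (simp add: field_simps add_pos_nonneg)
    have "norm ((1 / y x) * I / V) = ?r * norm I / x powr a"
      using norm_one_plus_i[of \<theta>] by (simp add: yx norm_mult norm_divide nV)
    also have "\<dots> \<le> ?r * (3 * \<kappa> * (x powr a) * (\<theta> / (1 + \<theta>\<^sup>2))) / x powr a"
      using nI r by (intro divide_right_mono mult_left_mono) auto
    also have "\<dots> = 3 * \<kappa> * (?r * \<theta> / (1 + \<theta>\<^sup>2))" using x by simp
    also have "\<dots> \<le> 3 * \<kappa> * 1" using rt k0 by (intro mult_left_mono) auto
    finally show ?thesis by simp
  qed
  finally show ?thesis by (simp add: yx)
qed

text \<open>The bound on \<open>S\<close> keeps its imaginary part away from \<open>\<pi>\<close>, so the principal branch is the right one.\<close>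
lemma Ln_approx:
  assumes S: "norm S \<le> 1" and X: "norm (X - exp S) \<le> \<delta>" and \<delta>: "\<delta> < 1 / 6"
  shows "norm (Ln X - S) \<le> 6 * \<delta>"
proof -
  define w where "w = X * exp (- S) - 1"
  have "w = (X - exp S) * exp (- S)" by (simp add: w_def left_diff_distrib exp_minus)
  hence "norm w = norm (X - exp S) * norm (exp (- S))" by (simp add: norm_mult)
  also have "\<dots> \<le> \<delta> * 3"
  proof (intro mult_mono X)
    have "norm (exp (- S)) \<le> exp (norm (- S))" by (rule norm_exp)
    also have "\<dots> \<le> exp 1" using S by simp
    also have "\<dots> \<le> 3" by (rule exp_le)
    finally show "norm (exp (- S)) \<le> 3" .
  qed (use order_trans[OF norm_ge_zero X] in auto)
  finally have w: "norm w \<le> 3 * \<delta>" by simp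
  hence w2: "norm w < 1 / 2" using \<delta> by simp
  have Ln: "norm (Ln (1 + w)) \<le> 2 * norm w" using w2 by (rule norm_Ln_le)
  have "1 + w \<noteq> 0" using w2 by (auto simp: add_eq_0_iff)
  hence "exp (S + Ln (1 + w)) = X" by (simp add: exp_add w_def exp_minus)
  moreover have "\<bar>Im (S + Ln (1 + w))\<bar> < pi"
  proof -
    have "\<bar>Im (S + Ln (1 + w))\<bar> \<le> norm S + norm (Ln (1 + w))"
      using abs_Im_le_cmod norm_triangle_ineq order_trans by blast
    also have "\<dots> < 2" using S Ln w2 by simp
    also have "2 < pi" using pi_gt3 by simp
    finally show ?thesis .
  qed
  ultimately have "Ln X = S + Ln (1 + w)"
    using Ln_exp[of "S + Ln (1 + w)"] by (auto simp: abs_less_iff)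
  thus ?thesis using Ln w by simp
qed

section \<open>Zeros of the oscillatory integral\<close>

lemma integral_pos:
  fixes f :: "real \<Rightarrow> real"
  assumes int: "f integrable_on {a..b}" and nn: "\<And>t. t \<in> {a..b} \<Longrightarrow> f t \<ge> 0"
    and sub: "a \<le> c" "c < d" "d \<le> b" and cont: "continuous_on {c..d} f" and pos: "f c > 0"
  shows "integral {a..b} f > 0"
proof -
  have "integral {c..d} f \<noteq> 0"
  proof
    assume "integral {c..d} f = 0"
    hence "\<forall>t\<in>{c..d}. f t = 0"
      using integral_eq_0_iff[OF cont] sub nn by simp
    thus False using sub pos by auto
  qed
  moreover have "integral {c..d} f \<ge> 0"
    using sub nn by (intro integral_nonneg integrable_continuous_real cont) auto
  moreover have "integral {c..d} f \<le> integral {a..b} f"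
    using sub nn by (intro integral_subset_le int integrable_continuous_real[OF cont]) auto
  ultimately show ?thesis by linarith
qed

lemma one_minus_cos_le: "1 - cos t \<le> t\<^sup>2 / 2" for t :: real
proof -
  have "\<bar>sin (t / 2)\<bar>\<^sup>2 \<le> \<bar>t / 2\<bar>\<^sup>2"
    by (intro power_mono abs_sin_x_le_abs_x) auto
  thus ?thesis using cos_double_sin[of "t / 2"] by (simp add: power_divide)
qed

text \<open>At \<open>0\<close> the double zero of \<open>1 - cos t\<close> compensates for the exponent \<open>a - 1 > -1\<close>.\<close>
lemma powr_times_one_minus_cos_continuous:
  fixes a z :: real
  assumes "a > 0"
  shows "continuous_on {0..z} (\<lambda>t. t powr (a - 1) * (1 - cos t))"
proof (rule continuous_on_eq_continuous_within[THEN iffD2, rule_format])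
  fix t assume t: "t \<in> {0..z}"
  show "continuous (at t within {0..z}) (\<lambda>t. t powr (a - 1) * (1 - cos t))"
  proof (cases "t = 0")
    case False
    hence "t > 0" using t by simp
    from has_real_derivative_powr[OF this, of "a - 1"]
    have "isCont (\<lambda>t. t powr (a - 1)) t" by (rule DERIV_isCont)
    moreover have "isCont (\<lambda>t. 1 - cos t) t" by (intro continuous_intros)
    ultimately have "isCont (\<lambda>t. t powr (a - 1) * (1 - cos t)) t" by (rule isCont_mult)
    thus ?thesis by (rule continuous_at_imp_continuous_within)
  next
    case True
    have "((\<lambda>t. t powr (a + 1)) \<longlongrightarrow> 0 powr (a + 1)) (at 0 within {0..z})"
    proof -
      have "continuous_on {0..z} (\<lambda>t. t powr (a + 1))"
        using assms by (intro continuous_on_powr' continuous_intros) auto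
      thus ?thesis using t unfolding True continuous_on_def by (rule bspec)
    qed
    hence lim: "((\<lambda>t. t powr (a + 1)) \<longlongrightarrow> 0) (at 0 within {0..z})" using assms by simp
    have "((\<lambda>t. t powr (a - 1) * (1 - cos t)) \<longlongrightarrow> 0) (at 0 within {0..z})"
    proof (rule tendsto_sandwich[OF _ _ tendsto_const lim])
      show "\<forall>\<^sub>F t in at 0 within {0..z}. 0 \<le> t powr (a - 1) * (1 - cos t)" by simp
      have "t powr (a - 1) * (1 - cos t) \<le> t powr (a + 1)" if "t > 0" for t :: real
      proof -
        have "t powr (a - 1) * (1 - cos t) \<le> t powr (a - 1) * t\<^sup>2"
          using one_minus_cos_le[of t] zero_le_power2[of t]
          by (intro mult_left_mono) (linarith, simp)
        also have "\<dots> = t powr (a + 1)" using that powr_add[of t "a - 1" 2] by (simp add: add.commute)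
        finally show ?thesis .
      qed
      thus "\<forall>\<^sub>F t in at 0 within {0..z}. t powr (a - 1) * (1 - cos t) \<le> t powr (a + 1)"
        by (auto simp: eventually_at_filter intro!: always_eventually)
    qed
    thus ?thesis by (simp add: continuous_within True)
  qed
qed

text \<open>
  Integrating by parts with the primitive \<open>1 - cos t \<ge> 0\<close> of \<open>sin t\<close> makes both resulting terms
  nonnegative, because \<open>t\<^sup>a\<^sup>-\<^sup>1\<close> decreases.
\<close>
lemma Im_osc_pos:
  assumes a: "0 < a" "a < 1" and z: "z > 0"
  shows "Im (osc a z) > 0"
proof -
  let ?f = "\<lambda>t. (1 - a) * t powr (a - 2) * (1 - cos t)"
  let ?p = "\<lambda>t. t powr (a - 1) * (1 - cos t)"
  have p: "((\<lambda>t. t powr (a - 1) * sin t - ?f t) has_integral ?p z - ?p 0) {0..z}"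
  proof (rule fundamental_theorem_of_calculus_interior[OF _ powr_times_one_minus_cos_continuous])
    fix t assume "t \<in> {0<..<z}"
    hence t: "t > 0" by simp
    have "(?p has_real_derivative t powr (a - 1) * sin t - ?f t) (at t)"
      using t by (auto intro!: derivative_eq_intros simp: algebra_simps)
    thus "(?p has_vector_derivative t powr (a - 1) * sin t - ?f t) (at t)"
      by (simp add: has_real_derivative_iff_has_vector_derivative)
  qed (use a z in auto)
  have "((\<lambda>t. t powr (a - 1) * sin t) has_integral Im (osc a z)) {0..z}"
    using has_integral_Im[OF integrable_integral[OF osc_integrable[of a z]]] a z
    by (simp add: osc_def)
  from has_integral_diff[OF this p] have f: "(?f has_integral Im (osc a z) - ?p z) {0..z}"
    by simp
  \<comment> \<open>\<open>1 - cos\<close> may vanish inside the interval; \<open>c\<close> is a point where it does not.\<close>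
  define c where "c = min (z / 2) pi"
  have c: "0 < c" "c < z" "c \<le> pi" using z by (auto simp: c_def min_def)
  have "cos c < 1" using cos_monotone_0_pi[of 0 c] c by simp
  hence "0 < integral {0..z} ?f"
    using a c by (intro integral_pos[where c = c and d = z] has_integral_integrable[OF f] continuous_intros) auto
  moreover have "0 \<le> ?p z" by simp
  ultimately show ?thesis using integral_unique[OF f] by linarith
qed

text \<open>
  The expression is \<open>\<integral> t\<^sup>a\<^sup>-\<^sup>1 sin (z - t) dt\<close>.  Measured from the right end point the weight decreases, and
  the primitive \<open>1 - cos (z - t)\<close> vanishes there, so this time both boundary terms are \<open>0\<close>.
\<close>
lemma osc_rotated_pos:
  assumes a: "a > 1" and z: "z > 0"
  shows "sin z * Re (osc a z) - cos z * Im (osc a z) > 0"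
proof -
  let ?f = "\<lambda>t. (a - 1) * t powr (a - 2) * (1 - cos (z - t))"
  let ?p = "\<lambda>t. t powr (a - 1) * (1 - cos (z - t))"
  have "((\<lambda>t. ?f t - t powr (a - 1) * sin (z - t)) has_integral ?p z - ?p 0) {0..z}"
  proof (rule fundamental_theorem_of_calculus_interior)
    show "continuous_on {0..z} ?p"
      using a by (intro continuous_intros continuous_on_powr') auto
    fix t assume "t \<in> {0<..<z}"
    hence t: "t > 0" by simp
    have "(?p has_real_derivative ?f t - t powr (a - 1) * sin (z - t)) (at t)"
      using t by (auto intro!: derivative_eq_intros simp: algebra_simps)
    thus "(?p has_vector_derivative ?f t - t powr (a - 1) * sin (z - t)) (at t)"
      by (simp add: has_real_derivative_iff_has_vector_derivative)
  qed (use z in auto)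
  moreover have "((\<lambda>t. t powr (a - 1) * sin (z - t)) has_integral
      sin z * Re (osc a z) - cos z * Im (osc a z)) {0..z}"
  proof -
    have *: "((\<lambda>t. of_real (t powr (a - 1)) * cis t) has_integral osc a z) {0..z}"
      unfolding osc_def using a z by (intro integrable_integral osc_integrable) auto
    have "((\<lambda>t. sin z * Re (of_real (t powr (a - 1)) * cis t) - cos z * Im (of_real (t powr (a - 1)) * cis t))
      has_integral sin z * Re (osc a z) - cos z * Im (osc a z)) {0..z}"
      by (intro has_integral_diff has_integral_mult_right has_integral_Re has_integral_Im *)
    thus ?thesis by (simp add: sin_diff algebra_simps)
  qed
  ultimately have "((\<lambda>t. ?f t - t powr (a - 1) * sin (z - t) + t powr (a - 1) * sin (z - t))
     has_integral (?p z - ?p 0) + (sin z * Re (osc a z) - cos z * Im (osc a z))) {0..z}"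
    by (rule has_integral_add)
  hence f: "(?f has_integral sin z * Re (osc a z) - cos z * Im (osc a z)) {0..z}"
    by simp
  define c where "c = max (z / 2) (z - pi)"
  have c: "0 < c" "c < z" "z - c \<le> pi" using z by (auto simp: c_def max_def)
  have "cos (z - c) < 1" using cos_monotone_0_pi[of 0 "z - c"] c by simp
  hence "0 < integral {0..z} ?f"
    using a c by (intro integral_pos[where c = c and d = z] has_integral_integrable[OF f] continuous_intros) auto
  thus ?thesis using integral_unique[OF f] by simp
qed

lemma osc_1:
  assumes "z \<ge> 0"
  shows "Re (osc 1 z) = sin z" "Im (osc 1 z) = 1 - cos z"
proof -
  have "((\<lambda>t. of_real (t powr (1 - 1)) * cis t) has_integral (- \<i> * cis z - - \<i> * cis 0)) {0..z}"
  proof (rule fundamental_theorem_of_calculus_interior)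
    fix t assume "t \<in> {0<..<z}"
    hence t: "t > 0" by simp
    have "((\<lambda>t. - \<i> * exp (\<i> * of_real t)) has_vector_derivative exp (\<i> * of_real t)) (at t)"
      by (rule has_vector_derivative_real_field derivative_eq_intros | simp add: mult.assoc)+
    thus "((\<lambda>t. - \<i> * cis t) has_vector_derivative of_real (t powr (1 - 1)) * cis t) (at t)"
      using t by (simp add: cis_conv_exp)
  qed (use assms in \<open>auto intro!: continuous_intros\<close>)
  hence "osc 1 z = - \<i> * cis z - - \<i> * cis 0"
    unfolding osc_def by (rule integral_unique)
  thus "Re (osc 1 z) = sin z" "Im (osc 1 z) = 1 - cos z" by simp_all
qed

lemma osc_nonzero:
  assumes a: "a > 0" and z: "z > 0" and ex: "\<not> (a = 1 \<and> (\<exists>k::nat. k \<ge> 1 \<and> z = 2 * pi * real k))"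
  shows "osc a z \<noteq> 0"
proof
  assume 0: "osc a z = 0"
  consider "a < 1" | "a > 1" | "a = 1" by linarith
  thus False
  proof cases
    case 1 thus ?thesis using Im_osc_pos[of a z] a z 0 by simp
  next
    case 2 thus ?thesis using osc_rotated_pos[of a z] z 0 by simp
  next
    case 3
    hence "cos z = 1" using osc_1(2)[of z] z 0 by simp
    then obtain k :: nat where "z = real k * 2 * pi \<or> z = - (real k * 2 * pi)"
      by (auto simp: cos_one_2pi)
    moreover have "\<not> z = - (real k * 2 * pi)"
      using z by (smt (verit) mult_nonneg_nonneg of_nat_0_le_iff pi_ge_zero)
    ultimately have "z = 2 * pi * real k" by simp
    moreover from this have "k \<ge> 1" using z by (cases k) auto
    ultimately show ?thesis using ex 3 by blast
  qed
qed

section \<open>The modulus-phase form and the expansion\<close>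

text \<open>At \<open>\<theta> = 0\<close>, where \<open>osc_factor\<close> is \<open>0 / 0 = 0\<close>, the value is the logarithm of the limit \<open>1\<close>.\<close>
definition log_factor :: "real \<Rightarrow> real \<Rightarrow> complex" where
  "log_factor a \<theta> = (if \<theta> = 0 then 0 else Ln (osc_factor a \<theta>))"

lemma osc_eq_polar:
  assumes a: "a > 0" and th: "\<theta> \<ge> 0"
    and ex: "\<not> (a = 1 \<and> (\<exists>k::nat. k \<ge> 1 \<and> \<theta> = 2 * pi * real k))"
  shows "osc a (a * \<theta>) = of_real ((a * \<theta>) powr a * exp (Re (log_factor a \<theta>)) / (a * sqrt (\<theta>\<^sup>2 + 1)))
    * cis (a * \<theta> - arctan \<theta> + Im (log_factor a \<theta>))"
proof (cases "\<theta> = 0")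
  case True
  thus ?thesis by (simp add: osc_def)
next
  case False
  define x where "x = a * \<theta>"
  define r where "r = sqrt (\<theta>\<^sup>2 + 1)"
  have x: "x > 0" using a th False by (simp add: x_def)
  have r: "r > 0" by (simp add: r_def add_nonneg_pos)
  have z: "osc a x \<noteq> 0"
    using ex by (intro osc_nonzero a x) (auto simp: x_def)
  have polar: "1 + \<i> * of_real \<theta> = of_real r * cis (arctan \<theta>)"
    using r by (simp add: complex_eq_iff cos_arctan sin_arctan r_def add.commute)
  have "osc_factor a \<theta> \<noteq> 0"
    using a r z x polar unfolding osc_factor_def x_def[symmetric] by simp
  hence "exp (log_factor a \<theta>) = osc_factor a \<theta>"
    using False by (simp add: log_factor_def)
  hence e: "of_real (exp (Re (log_factor a \<theta>))) * cis (Im (log_factor a \<theta>)) = osc_factor a \<theta>"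
    by (simp add: exp_eq_polar)
  have c: "cis (x - arctan \<theta> + Im (log_factor a \<theta>)) = cis x / cis (arctan \<theta>) * cis (Im (log_factor a \<theta>))"
    by (simp add: cis_mult[symmetric] cis_divide)
  have "of_real (x powr a * exp (Re (log_factor a \<theta>)) / (a * r)) * cis (x - arctan \<theta> + Im (log_factor a \<theta>))
    = of_real (x powr a) * cis x / (of_real a * (of_real r * cis (arctan \<theta>)))
        * (of_real (exp (Re (log_factor a \<theta>))) * cis (Im (log_factor a \<theta>)))"
    unfolding c by (simp add: mult_ac)
  also have "\<dots> = osc a x"
    unfolding e osc_factor_def x_def[symmetric] polar using a r x by simp
  finally show ?thesis by (simp add: x_def r_def)
qed

text \<open>
  The complex form of both expansions.  The thresholds for \<open>a\<close> serve the hypotheses of \<open>Ln_approx\<close>: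
  \<open>a \<ge> D\<close> gives an exponent of modulus at most \<open>1\<close>, and \<open>a \<ge> 31 C\<close> makes the error \<open>5 C \<epsilon>\<^sup>N\<^sup>+\<^sup>1\<close> less than
  \<open>1/6\<close>.
\<close>
lemma log_factor_expansion:
  "\<exists>C. \<forall>\<^sub>F a in at_top. \<forall>\<theta>\<in>{0..}.
     norm (log_factor a \<theta> - (\<Sum>s=1..N. (-1) ^ s * E_minus s (- (\<i> * of_real \<theta>)) / of_real a ^ s)) \<le> C / a ^ (N + 1)"
proof -
  obtain C where C: "\<And>\<epsilon> y. \<epsilon> \<in> {0..1} \<Longrightarrow> y \<in> cball 0 1 \<Longrightarrow>
     norm (exp (poly (expo_sum N (of_real \<epsilon>)) y) * poly (resid_poly (expo_sum N (of_real \<epsilon>)) (of_real \<epsilon>)) y)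
       \<le> C * \<epsilon> ^ (N + 1)" using exp_resid_bound by metis
  obtain D where D: "\<And>\<epsilon> y. \<epsilon> \<in> {0..1} \<Longrightarrow> y \<in> cball 0 1 \<Longrightarrow>
     norm (poly (expo_sum N (of_real \<epsilon>)) y) \<le> D * \<epsilon>" using expo_sum_bound by metis
  have C0: "C \<ge> 0" using order_trans[OF norm_ge_zero C[of 1 0]] by simp
  show ?thesis
  proof (intro exI[of _ "30 * C"] eventually_mono[OF eventually_ge_at_top[of "max 2 (max D (31 * C))"]] ballI)
    fix a \<theta> :: real assume "max 2 (max D (31 * C)) \<le> a" and th: "\<theta> \<in> {0..}"
    hence a: "a \<ge> 2" "a \<ge> D" "a \<ge> 31 * C" by auto
    define \<epsilon> where "\<epsilon> = 1 / a"
    have e: "\<epsilon> \<in> {0..1}" "\<epsilon> > 0" using a by (auto simp: \<epsilon>_def)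
    define s where "s = expo_sum N (of_real \<epsilon>)"
    define y where "y = 1 / (1 + \<i> * complex_of_real \<theta>)"
    have y: "y \<in> cball 0 1"
      unfolding mem_cball dist_0_norm y_def norm_divide norm_one_plus_i norm_one by (rule inverse_sqrt_le_1)
    have S: "(\<Sum>k=1..N. (-1) ^ k * E_minus k (- (\<i> * of_real \<theta>)) / of_real a ^ k) = poly s y"
      unfolding s_def poly_expo_sum
    proof (intro sum.cong refl)
      fix k assume "k \<in> {1..N}"
      hence "E_minus k (- (\<i> * of_real \<theta>)) = (-1) ^ k * poly (expo_coeff k) y"
        using th unfolding y_def by (intro E_minus_eq_poly) auto
      thus "(-1) ^ k * E_minus k (- (\<i> * of_real \<theta>)) / of_real a ^ k = of_real \<epsilon> ^ k * poly (expo_coeff k) y"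
        by (simp add: \<epsilon>_def power_divide mult.assoc[symmetric] power_mult_distrib[symmetric])
    qed
    have s1: "poly s 1 = 0" by (simp add: s_def poly_expo_sum poly_expo_coeff_1)
    show "norm (log_factor a \<theta> - (\<Sum>k=1..N. (-1) ^ k * E_minus k (- (\<i> * of_real \<theta>)) / of_real a ^ k))
       \<le> 30 * C / a ^ (N + 1)"
    proof (cases "\<theta> = 0")
      case True
      thus ?thesis unfolding S using C0 a s1 by (simp add: log_factor_def y_def)
    next
      case False
      have X: "norm (osc_factor a \<theta> - exp (poly s y)) \<le> 5 * (C * \<epsilon> ^ (N + 1))"
        unfolding y_def
        using False th a s1 C[OF e(1)]
        by (intro osc_factor_approx) (auto simp: s_def \<epsilon>_def)
      have "D * \<epsilon> \<le> 1" using a by (simp add: \<epsilon>_def)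
      hence n: "norm (poly s y) \<le> 1" using D[OF e(1) y] by (simp add: s_def)
      have "C * \<epsilon> ^ (N + 1) \<le> C * \<epsilon> ^ 1"
        using e C0 by (intro mult_left_mono power_decreasing) auto
      also have "\<dots> \<le> 1 / 31" using a by (simp add: \<epsilon>_def field_simps)
      finally have "5 * (C * \<epsilon> ^ (N + 1)) < 1 / 6" by simp
      from Ln_approx[OF n X this] show ?thesis
        unfolding S using False by (simp add: log_factor_def \<epsilon>_def power_divide)
    qed
  qed
qed

theorem mainTheorem3:
  shows "\<exists>E\<^sub>R E\<^sub>I :: real \<Rightarrow> real \<Rightarrow> real.
    (\<forall>a \<theta> \<alpha> :: real.
       a > 0 \<longrightarrow> \<theta> \<ge> 0 \<longrightarrow> 0 \<le> \<alpha> \<longrightarrow> \<alpha> < 1 \<longrightarrow>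
       \<not> (a = 1 \<and> (\<exists>k::nat. k \<ge> 1 \<and> \<theta> = 2 * pi * real k)) \<longrightarrow>
         gen_Ci a (a * \<theta>) = (a * \<theta>) powr a * exp (E\<^sub>R a \<theta>) / (a * sqrt (\<theta>\<^sup>2 + 1))
            * cos (a * \<theta> - arctan \<theta> + E\<^sub>I a \<theta>) \<and>
         gen_Si a (a * \<theta>) = (a * \<theta>) powr a * exp (E\<^sub>R a \<theta>) / (a * sqrt (\<theta>\<^sup>2 + 1))
            * sin (a * \<theta> - arctan \<theta> + E\<^sub>I a \<theta>) \<and>
         gen_Ti a (a * \<theta>) \<alpha> = (a * \<theta>) powr a * exp (E\<^sub>R a \<theta>) / (a * sqrt (\<theta>\<^sup>2 + 1))
            * cos (a * \<theta> - arctan \<theta> - \<alpha> * pi + E\<^sub>I a \<theta>)) \<and>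
    uniform_asymp_expansion E\<^sub>R
      (\<lambda>s \<theta>. (-1) ^ s * Re (E_minus s (- (\<i> * of_real \<theta>)))) {0..} \<and>
    uniform_asymp_expansion E\<^sub>I
      (\<lambda>s \<theta>. (-1) ^ s * Im (E_minus s (- (\<i> * of_real \<theta>)))) {0..}"
proof (rule exI[of _ "\<lambda>a \<theta>. Re (log_factor a \<theta>)"], rule exI[of _ "\<lambda>a \<theta>. Im (log_factor a \<theta>)"],
    intro conjI[rotated])
  let ?c = "\<lambda>s \<theta>. (-1) ^ s * E_minus s (- (\<i> * complex_of_real \<theta>))"
  have minus_one: "(-1 :: complex) ^ s = of_real ((-1) ^ s)" for s by simp
  have Re: "Re (?c s \<theta> / of_real a ^ s) = (-1) ^ s * Re (E_minus s (- (\<i> * of_real \<theta>))) / a ^ s"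
    and Im: "Im (?c s \<theta> / of_real a ^ s) = (-1) ^ s * Im (E_minus s (- (\<i> * of_real \<theta>))) / a ^ s" for s a \<theta>
    unfolding minus_one of_real_power[symmetric] by (simp_all del: of_real_power)
  \<comment> \<open>Real and imaginary part are treated together, as a real-linear \<open>g\<close> with \<open>\<bar>g u\<bar> \<le> norm u\<close>.\<close>
  have "uniform_asymp_expansion (\<lambda>a \<theta>. g (log_factor a \<theta>)) c {0..}"
    if g: "\<And>u v. g (u - v) = g u - g v" "\<And>(f :: nat \<Rightarrow> complex) A. g (sum f A) = (\<Sum>s\<in>A. g (f s))" "\<And>u. \<bar>g u\<bar> \<le> norm u"
      and c: "\<And>s a \<theta>. g (?c s \<theta> / of_real a ^ s) = c s \<theta> / a ^ s" for g :: "complex \<Rightarrow> real" and c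
    unfolding uniform_asymp_expansion_def
  proof
    fix N
    obtain C where C: "\<forall>\<^sub>F a in at_top. \<forall>\<theta>\<in>{0..}.
        norm (log_factor a \<theta> - (\<Sum>s=1..N. ?c s \<theta> / of_real a ^ s)) \<le> C / a ^ (N + 1)"
      using log_factor_expansion by blast
    have "\<bar>g (log_factor a \<theta>) - (\<Sum>s=1..N. c s \<theta> / a ^ s)\<bar>
        \<le> norm (log_factor a \<theta> - (\<Sum>s=1..N. ?c s \<theta> / of_real a ^ s))" for a \<theta>
      using g(3)[of "log_factor a \<theta> - (\<Sum>s=1..N. ?c s \<theta> / of_real a ^ s)"] unfolding g(1,2) c .
    thus "\<exists>C. \<forall>\<^sub>F a in at_top. \<forall>\<theta>\<in>{0..}.
        \<bar>g (log_factor a \<theta>) - (\<Sum>s=1..N. c s \<theta> / a ^ s)\<bar> \<le> C / a ^ (N + 1)"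
      using C by (intro exI[of _ C], elim eventually_mono) (blast intro: order_trans)
  qed
  from this[of Re, OF _ _ _ Re] this[of Im, OF _ _ _ Im]
  show "uniform_asymp_expansion (\<lambda>a \<theta>. Re (log_factor a \<theta>))
      (\<lambda>s \<theta>. (-1) ^ s * Re (E_minus s (- (\<i> * of_real \<theta>)))) {0..}"
    and "uniform_asymp_expansion (\<lambda>a \<theta>. Im (log_factor a \<theta>))
      (\<lambda>s \<theta>. (-1) ^ s * Im (E_minus s (- (\<i> * of_real \<theta>)))) {0..}"
    by (simp_all add: abs_Re_le_cmod abs_Im_le_cmod)
next
  show "\<forall>a \<theta> \<alpha> :: real.
       a > 0 \<longrightarrow> \<theta> \<ge> 0 \<longrightarrow> 0 \<le> \<alpha> \<longrightarrow> \<alpha> < 1 \<longrightarrow>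
       \<not> (a = 1 \<and> (\<exists>k::nat. k \<ge> 1 \<and> \<theta> = 2 * pi * real k)) \<longrightarrow>
         gen_Ci a (a * \<theta>) = (a * \<theta>) powr a * exp (Re (log_factor a \<theta>)) / (a * sqrt (\<theta>\<^sup>2 + 1))
            * cos (a * \<theta> - arctan \<theta> + Im (log_factor a \<theta>)) \<and>
         gen_Si a (a * \<theta>) = (a * \<theta>) powr a * exp (Re (log_factor a \<theta>)) / (a * sqrt (\<theta>\<^sup>2 + 1))
            * sin (a * \<theta> - arctan \<theta> + Im (log_factor a \<theta>)) \<and>
         gen_Ti a (a * \<theta>) \<alpha> = (a * \<theta>) powr a * exp (Re (log_factor a \<theta>)) / (a * sqrt (\<theta>\<^sup>2 + 1))
            * cos (a * \<theta> - arctan \<theta> - \<alpha> * pi + Im (log_factor a \<theta>))"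
  proof (intro allI impI)
    fix a \<theta> \<alpha> :: real
    assume a: "a > 0" and th: "\<theta> \<ge> 0"
      and ex: "\<not> (a = 1 \<and> (\<exists>k::nat. k \<ge> 1 \<and> \<theta> = 2 * pi * real k))"
    define M where "M = (a * \<theta>) powr a * exp (Re (log_factor a \<theta>)) / (a * sqrt (\<theta>\<^sup>2 + 1))"
    define \<phi> where "\<phi> = a * \<theta> - arctan \<theta> + Im (log_factor a \<theta>)"
    have "osc a (a * \<theta>) = of_real M * cis \<phi>"
      unfolding M_def \<phi>_def by (rule osc_eq_polar[OF a th ex])
    hence CS: "gen_Ci a (a * \<theta>) = M * cos \<phi>" "gen_Si a (a * \<theta>) = M * sin \<phi>"
      using a th by (simp_all add: gen_Ci_eq_Re_osc gen_Si_eq_Im_osc)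
    have "gen_Ti a (a * \<theta>) \<alpha> = M * cos (\<phi> - \<alpha> * pi)"
      unfolding gen_Ti_def CS cos_diff by (simp add: algebra_simps)
    also have "\<phi> - \<alpha> * pi = a * \<theta> - arctan \<theta> - \<alpha> * pi + Im (log_factor a \<theta>)"
      by (simp add: \<phi>_def)
    finally have T: "gen_Ti a (a * \<theta>) \<alpha> = M * cos (a * \<theta> - arctan \<theta> - \<alpha> * pi + Im (log_factor a \<theta>))" .
    show "gen_Ci a (a * \<theta>) = (a * \<theta>) powr a * exp (Re (log_factor a \<theta>)) / (a * sqrt (\<theta>\<^sup>2 + 1))
            * cos (a * \<theta> - arctan \<theta> + Im (log_factor a \<theta>)) \<and>
         gen_Si a (a * \<theta>) = (a * \<theta>) powr a * exp (Re (log_factor a \<theta>)) / (a * sqrt (\<theta>\<^sup>2 + 1))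
            * sin (a * \<theta> - arctan \<theta> + Im (log_factor a \<theta>)) \<and>
         gen_Ti a (a * \<theta>) \<alpha> = (a * \<theta>) powr a * exp (Re (log_factor a \<theta>)) / (a * sqrt (\<theta>\<^sup>2 + 1))
            * cos (a * \<theta> - arctan \<theta> - \<alpha> * pi + Im (log_factor a \<theta>))"
      unfolding M_def[symmetric] \<phi>_def[symmetric] using CS T by blast
  qed
qed

end
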